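(* Let $f:\mathbb{R}^N\to\mathbb{R}$ be continuously differentiable, let $S=\{x\in\mathbb{R}^N : \|x\|_0\le s\}$, and consider the problem $\min f(x)$ subject to $x\in S$. Let $\alpha>0$ and $x^*\in S$. Then: $x^*$ is an $\alpha$-stationary point $\Longrightarrow$ $x^*$ is an $N^C$-stationary point $\Longleftrightarrow$ $x^*$ is a $T^C$-stationary point.
   Context: $N$ and $s$ are positive integers with $s<N$; $\|x\|_0$ is the number of nonzero entries of $x\in\mathbb{R}^N$; $\|\cdot\|$ is the Euclidean norm. $P_S(x)=\arg\min_{y\in S}\|x-y\|$ is the (set-valued) projection onto $S$. The Clarke tangent cone $T^C_\Omega(\overline{x})$ of a nonempty set $\Omega\subseteq\mathbb{R}^N$ at $\overline{x}\in\Omega$ is the set of all $d\in\mathbb{R}^N$ such that for every sequence $\{x^k\}\subset\Omega$ with $\lim_{k\to\infty}x^k=\overline{x}$ and every sequence $\{\lambda_k\}\subset\mathbb{R}_+$ with $\lim_{k\to\infty}\lambda_k=0$ there exists a sequence $\{y^k\}\subset\mathbb{R}^N$ with $\lim_{k\to\infty}y^k=d$ and $x^k+\lambda_k y^k\in\Omega$ for $k=1,2,\dots$; and $N^C_\Omega(\overline{x})=\{d\in\mathbb{R}^N : \langle d,z\rangle\le0\ \ \forall z\in T^C_\Omega(\overline{x})\}$. A point $x^*\in S$ is called: - an $\alpha$-stationary point if $x^*\in P_S(x^*-\alpha\nabla f(x^* ))$; - an $N^C$-stationary point if $0\in\nabla f(x^* )+N^C_S(x^* )$; - a $T^C$-stationary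 point if $\|\nabla^C_S f(x^* )\|=0$, where $\nabla^C_S f(x^* )=\arg\min\{\|d+\nabla f(x^* )\| : d\in T^C_S(x^* )\}$. *)

theory Defs
  imports "HOL-Analysis.Analysis"
begin

definition l0_norm :: "real ^ 'n \<Rightarrow> nat" where
  "l0_norm x = card {i. x $ i \<noteq> 0}"

definition sparse_set :: "nat \<Rightarrow> (real ^ 'n) set" where
  "sparse_set s = {x. l0_norm x \<le> s}"

definition grad :: "('a::euclidean_space \<Rightarrow> real) \<Rightarrow> 'a \<Rightarrow> 'a" where
  "grad f x = (THE D. GDERIV f x :> D)"

lemma GDERIV_grad:
  assumes "f differentiable at x"
  shows "GDERIV f x :> grad f x"
proof -
  obtain f' where f': "(f has_derivative f') (at x)"
    using assms by (auto simp: differentiable_def)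
  have lin: "linear f'"
    using f' by (rule has_derivative_linear)
  define D where "D = (\<Sum>b\<in>Basis. f' b *\<^sub>R b)"
  have "f' h = h \<bullet> D" for h
  proof -
    have "f' h = f' (\<Sum>b\<in>Basis. (h \<bullet> b) *\<^sub>R b)"
      by (simp add: euclidean_representation)
    also have "\<dots> = (\<Sum>b\<in>Basis. (h \<bullet> b) * f' b)"
      using lin by (simp add: linear_sum linear_scale)
    also have "\<dots> = h \<bullet> D"
      by (simp add: D_def inner_sum_right mult.commute)
    finally show ?thesis .
  qed
  then have D: "GDERIV f x :> D"
    using f' unfolding gderiv_def by (metis (no_types, lifting) ext)
  have "E = D" if "GDERIV f x :> E" for E
  proof -
    have "(\<lambda>h. h \<bullet> E) = (\<lambda>h. h \<bullet> D)"
      using that D unfolding gderiv_def by (rule has_derivative_unique)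
    then have "\<forall>h. h \<bullet> E = h \<bullet> D" by metis
    then show ?thesis by (metis vector_eq_ldot)
  qed
  with D show ?thesis
    unfolding grad_def by (metis (no_types, lifting) theI)
qed

definition proj_set :: "('a::euclidean_space) set \<Rightarrow> 'a \<Rightarrow> 'a set" where
  "proj_set S x = {y. is_arg_min (\<lambda>y. norm (x - y)) (\<lambda>y. y \<in> S) y}"

definition clarke_tangent_cone :: "('a::euclidean_space) set \<Rightarrow> 'a \<Rightarrow> 'a set" where
  "clarke_tangent_cone \<Omega> x =
    {d. \<forall>X l. (\<forall>k. X k \<in> \<Omega>) \<longrightarrow> X \<longlonglongrightarrow> x \<longrightarrow> (\<forall>k. (0::real) \<le> l k) \<longrightarrow> l \<longlonglongrightarrow> 0 \<longrightarrow>
          (\<exists>Y. Y \<longlonglongrightarrow> d \<and> (\<forall>k::nat. X k + l k *\<^sub>R Y k \<in> \<Omega>))}"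

definition clarke_normal_cone :: "('a::euclidean_space) set \<Rightarrow> 'a \<Rightarrow> 'a set" where
  "clarke_normal_cone \<Omega> x = {d. \<forall>z\<in>clarke_tangent_cone \<Omega> x. d \<bullet> z \<le> 0}"

text \<open>The Clarke tangent cone at a point of the set is a nonempty closed convex cone, so the
  minimizer below exists and is unique; it is treated as a vector.\<close>

definition clarke_proj_grad :: "('a::euclidean_space) set \<Rightarrow> ('a \<Rightarrow> real) \<Rightarrow> 'a \<Rightarrow> 'a" where
  "clarke_proj_grad S f x = arg_min_on (\<lambda>d. norm (d + grad f x)) (clarke_tangent_cone S x)"

definition alpha_stationary ::
  "real \<Rightarrow> ('a::euclidean_space) set \<Rightarrow> ('a \<Rightarrow> real) \<Rightarrow> 'a \<Rightarrow> bool" where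
  "alpha_stationary \<alpha> S f x \<longleftrightarrow> x \<in> S \<and> x \<in> proj_set S (x - \<alpha> *\<^sub>R grad f x)"

definition NC_stationary :: "('a::euclidean_space) set \<Rightarrow> ('a \<Rightarrow> real) \<Rightarrow> 'a \<Rightarrow> bool" where
  "NC_stationary S f x \<longleftrightarrow> x \<in> S \<and> 0 \<in> (\<lambda>v. grad f x + v) ` clarke_normal_cone S x"

definition TC_stationary :: "('a::euclidean_space) set \<Rightarrow> ('a \<Rightarrow> real) \<Rightarrow> 'a \<Rightarrow> bool" where
  "TC_stationary S f x \<longleftrightarrow> x \<in> S \<and> norm (clarke_proj_grad S f x) = 0"

end

theory Submission
  imports Defs
begin

text \<open>The Clarke tangent cone of the sparse set at a point \<open>x\<close> is the subspace of vectors supported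
  on the support of \<open>x\<close>. A direction with another nonzero coordinate \<open>i\<close> is excluded by approaching
  \<open>x\<close> through points whose support consists of exactly \<open>s\<close> indices different from \<open>i\<close>, which exist
  because \<open>s < N\<close>. Let \<open>p\<close> be the projection of the negative gradient onto this subspace. Each of
  N- and T-stationarity says that \<open>p\<close> vanishes; if \<open>p\<close> does not vanish, then
  \<open>x + \<alpha> p\<close> is sparse and strictly closer to \<open>x - \<alpha> \<nabla>f(x)\<close> than \<open>x\<close>.\<close>

definition supported_on :: "'n set \<Rightarrow> (real ^ 'n) set" where
  "supported_on A = {d. \<forall>i. d $ i \<noteq> 0 \<longrightarrow> i \<in> A}"

text \<open>This is the orthogonal projection onto the coordinate subspace
  \<open>supported_on A\<close>.\<close>

definition restrict_to :: "'n set \<Rightarrow> real ^ 'n \<Rightarrow> real ^ 'n" where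
  "restrict_to A v = (\<chi> i. if i \<in> A then v $ i else 0)"

lemma l0_norm_mono:
  assumes "\<And>i. y $ i \<noteq> 0 \<Longrightarrow> z $ i \<noteq> 0"
  shows "l0_norm y \<le> l0_norm z"
  unfolding l0_norm_def using assms by (auto intro!: card_mono)

lemma inner_supported_on:
  assumes "d \<in> supported_on A"
  shows "v \<bullet> d = restrict_to A v \<bullet> d"
  using assms unfolding inner_vec_def
  by (intro sum.cong) (auto simp: restrict_to_def supported_on_def)

text \<open>Pythagoras: the first summand on the right comes from a vector living on
  \<open>A\<close>, the second from one vanishing on \<open>A\<close>. Only the first depends on
  \<open>d\<close>.\<close>

lemma norm_add_supported_on:
  assumes "d \<in> supported_on A"
  shows "(norm (d + v))\<^sup>2 =
    (norm (d + restrict_to A v))\<^sup>2 + (norm (v - restrict_to A v))\<^sup>2"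
proof -
  have "(d + restrict_to A v) \<bullet> (v - restrict_to A v) = 0"
    using assms unfolding inner_vec_def
    by (intro sum.neutral) (auto simp: restrict_to_def supported_on_def)
  then show ?thesis
    using norm_add_Pythagorean[of "d + restrict_to A v" "v - restrict_to A v"]
    by (simp add: orthogonal_def)
qed

lemma arg_min_norm_supported_on:
  "arg_min_on (\<lambda>d. norm (d + v)) (supported_on A) = - restrict_to A v"
proof -
  let ?p = "- restrict_to A v"
  have p: "?p \<in> supported_on A"
    by (simp add: restrict_to_def supported_on_def)
  have less: "norm (?p + v) < norm (d + v)" if "d \<in> supported_on A" "d \<noteq> ?p" for d
  proof -
    have "d + restrict_to A v \<noteq> 0"
      using that(2) by (simp add: eq_neg_iff_add_eq_0)
    then have "(norm (?p + v))\<^sup>2 < (norm (d + v))\<^sup>2"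
      using norm_add_supported_on[OF that(1), of v] norm_add_supported_on[OF p, of v] by simp
    then show ?thesis
      by (rule power2_less_imp_less) simp
  qed
  \<comment> \<open>\<open>arg_min_on\<close> is a choice operator, so its value is determined only
    once the minimizer is known to be unique.\<close>
  have "is_arg_min (\<lambda>d. norm (d + v)) (\<lambda>d. d \<in> supported_on A) d \<longleftrightarrow> d = ?p" for d
    unfolding is_arg_min_def using p less by (metis less_asym)
  then show ?thesis
    by (simp add: arg_min_on_def arg_min_def)
qed

text \<open>A coordinate with nonzero limit is eventually nonzero, and finitely many coordinates
  allow a common threshold.\<close>

lemma eventually_support_superset:
  assumes "X \<longlonglongrightarrow> (x :: real ^ 'n)"
  shows "eventually (\<lambda>k. \<forall>i. x $ i \<noteq> 0 \<longrightarrow> X k $ i \<noteq> 0) sequentially"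
proof -
  have "eventually (\<lambda>k. x $ i \<noteq> 0 \<longrightarrow> X k $ i \<noteq> 0) sequentially" for i
    using tendsto_imp_eventually_ne[OF tendsto_vec_nth[OF assms]] by (cases "x $ i = 0") auto
  then show ?thesis
    by (rule eventually_all_finite)
qed

text \<open>For all large \<open>k\<close> the support of \<open>X k\<close> contains that of
  \<open>x\<close>, so a step along \<open>d\<close> creates no new nonzero entry, whatever its
  length.\<close>

lemma supported_on_subset_clarke_tangent_cone:
  "supported_on {i. x $ i \<noteq> 0} \<subseteq> clarke_tangent_cone (sparse_set s) x"
proof
  fix d assume d: "d \<in> supported_on {i. x $ i \<noteq> 0}"
  show "d \<in> clarke_tangent_cone (sparse_set s) x"
    unfolding clarke_tangent_cone_def
  proof (intro CollectI allI impI)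
    fix X l
    assume X: "\<forall>k. X k \<in> sparse_set s" "X \<longlonglongrightarrow> x"
    let ?Q = "\<lambda>k. \<forall>i. x $ i \<noteq> 0 \<longrightarrow> X k $ i \<noteq> 0"
    \<comment> \<open>The value 0 serves the early \<open>k\<close>, where the support of
      \<open>X k\<close> may still miss part of that of \<open>x\<close>; the point then stays at
      \<open>X k\<close>.\<close>
    define Y where "Y k = (if ?Q k then d else 0)" for k
    have "Y \<longlonglongrightarrow> d"
      by (rule tendsto_eventually)
        (use eventually_support_superset[OF X(2)] in eventually_elim, simp add: Y_def)
    moreover have "X k + (l k :: real) *\<^sub>R Y k \<in> sparse_set s" for k
    proof -
      have "l0_norm (X k + l k *\<^sub>R Y k) \<le> l0_norm (X k)"
        by (rule l0_norm_mono) (use d in \<open>auto simp: Y_def supported_on_def split: if_splits\<close>)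
      then show ?thesis
        using X(1) by (auto simp: sparse_set_def intro: order_trans)
    qed
    ultimately show "\<exists>Y. Y \<longlonglongrightarrow> d \<and> (\<forall>k. X k + l k *\<^sub>R Y k \<in> sparse_set s)"
      by blast
  qed
qed

lemma clarke_tangent_cone_subset_supported_on:
  fixes x :: "real ^ 'n"
  assumes s: "s < CARD('n)" and x: "x \<in> sparse_set s"
  shows "clarke_tangent_cone (sparse_set s) x \<subseteq> supported_on {i. x $ i \<noteq> 0}"
proof
  fix d assume d: "d \<in> clarke_tangent_cone (sparse_set s) x"
  let ?A = "{i. x $ i \<noteq> 0}"
  show "d \<in> supported_on ?A"
    unfolding supported_on_def mem_Collect_eq[of d]
  proof (intro allI impI)
    fix i assume di: "d $ i \<noteq> 0"
    show "i \<in> ?A"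
    proof (rule ccontr)
      assume i: "i \<notin> ?A"
      have cA: "card ?A \<le> s"
        using x by (simp add: sparse_set_def l0_norm_def)
      have "s \<le> card (UNIV - {i})"
        using s by simp
      then obtain B where B: "?A \<subseteq> B" "B \<subseteq> UNIV - {i}" "card B = s"
        using exists_subset_between[of ?A s "UNIV - {i}"] cA i by auto
      \<comment> \<open>Adding a positive multiple of \<open>u\<close> to \<open>x\<close> enlarges
        the support to exactly \<open>B\<close>, which leaves no room for the index
        \<open>i\<close>.\<close>
      define u :: "real ^ 'n" where "u = (\<chi> j. if j \<in> B - ?A then 1 else 0)"
      define e where "e k = inverse (real (Suc k))" for k
      define X where "X k = x + e k *\<^sub>R u" for k
      have e: "e \<longlonglongrightarrow> 0" "\<And>k. e k > 0"
        unfolding e_def using LIMSEQ_inverse_real_of_nat by (auto simp: divide_inverse)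
      have "l0_norm (X k) \<le> s" for k
        unfolding l0_norm_def B(3)[symmetric]
        by (rule card_mono) (use B(1) in \<open>auto simp: X_def u_def split: if_splits\<close>)
      then have XS: "\<forall>k. X k \<in> sparse_set s"
        by (simp add: sparse_set_def)
      have "(\<lambda>k. x + e k *\<^sub>R u) \<longlonglongrightarrow> x + 0 *\<^sub>R u"
        by (intro tendsto_intros e)
      then have XL: "X \<longlonglongrightarrow> x"
        by (simp add: X_def[abs_def])
      have l: "(\<lambda>k. e k * e k) \<longlonglongrightarrow> 0"
        using tendsto_mult[OF e(1) e(1)] by simp
      \<comment> \<open>The step size is of smaller order than the perturbation, so it cannot cancel it.\<close>
      obtain Y where Y: "Y \<longlonglongrightarrow> d" "\<And>k. X k + (e k * e k) *\<^sub>R Y k \<in> sparse_set s"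
        using d XS XL l unfolding clarke_tangent_cone_def
        by (force dest: spec[of _ X] spec[of _ "\<lambda>k. e k * e k"])
      let ?Z = "\<lambda>k. X k + (e k * e k) *\<^sub>R Y k"
      have "(\<lambda>k. X k + (e k * e k) *\<^sub>R Y k) \<longlonglongrightarrow> x + 0 *\<^sub>R d"
        by (intro tendsto_add XL tendsto_scaleR l Y(1))
      then have "eventually (\<lambda>k. \<forall>j. x $ j \<noteq> 0 \<longrightarrow> ?Z k $ j \<noteq> 0) sequentially"
        by (intro eventually_support_superset) simp
      moreover have "eventually (\<lambda>k. \<forall>j. d $ j \<noteq> 0 \<longrightarrow> Y k $ j \<noteq> 0) sequentially"
        by (rule eventually_support_superset[OF Y(1)])
      moreover have "(\<lambda>k. u + e k *\<^sub>R Y k) \<longlonglongrightarrow> u + 0 *\<^sub>R d"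
        by (intro tendsto_intros e Y(1))
      then have "eventually (\<lambda>k. \<forall>j. u $ j \<noteq> 0 \<longrightarrow> (u + e k *\<^sub>R Y k) $ j \<noteq> 0) sequentially"
        by (intro eventually_support_superset) simp
      \<comment> \<open>Each index has its own reason: on \<open>?A\<close> the limit
        \<open>x\<close> is nonzero, on the rest of \<open>B\<close> the vector \<open>u\<close> is,
        and at \<open>i\<close> the direction \<open>d\<close> is.\<close>
      ultimately have "eventually (\<lambda>k. insert i B \<subseteq> {j. ?Z k $ j \<noteq> 0}) sequentially"
      proof eventually_elim
        case (elim k)
        have "?Z k $ j \<noteq> 0" if "j \<in> insert i B" for j
        proof (cases "j \<in> ?A")
          case True
          then show ?thesis using elim(1) by blast
        next
          case False
          \<comment> \<open>Off the support of \<open>x\<close> one factor \<open>e k\<close> splits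
            off; at \<open>j = i\<close>, where \<open>u\<close> vanishes, what remains is
            \<open>e k\<close> times the entry of \<open>Y k\<close>.\<close>
          have Z: "?Z k $ j = e k * (u + e k *\<^sub>R Y k) $ j"
            using False by (simp add: X_def algebra_simps)
          have "(u + e k *\<^sub>R Y k) $ j \<noteq> 0"
          proof (cases "j = i")
            case True
            then show ?thesis
              using elim(2) di B(2) e(2)[of k] by (auto simp: u_def)
          next
            case False
            then show ?thesis
              using elim(3)[rule_format, of j] that \<open>j \<notin> ?A\<close> by (auto simp: u_def)
          qed
          then show ?thesis
            using Z e(2)[of k] by simp
        qed
        then show ?case by blast
      qed
      then obtain k where k: "insert i B \<subseteq> {j. ?Z k $ j \<noteq> 0}"
        by (auto dest: eventually_happens)
      then have "card (insert i B) \<le> l0_norm (?Z k)"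
        unfolding l0_norm_def by (intro card_mono) auto
      moreover have "card (insert i B) = Suc s"
        using B by (subst card_insert_disjoint) auto
      moreover have "l0_norm (?Z k) \<le> s"
        using Y(2)[of k] by (simp add: sparse_set_def)
      ultimately show False by simp
    qed
  qed
qed

lemma clarke_tangent_cone_sparse_set:
  fixes x :: "real ^ 'n"
  assumes "s < CARD('n)" and "x \<in> sparse_set s"
  shows "clarke_tangent_cone (sparse_set s) x = supported_on {i. x $ i \<noteq> 0}"
  using clarke_tangent_cone_subset_supported_on[OF assms] supported_on_subset_clarke_tangent_cone
  by blast

lemma NC_stationary_sparse_set_iff:
  fixes x :: "real ^ 'n"
  assumes "s < CARD('n)" and "x \<in> sparse_set s"
  shows "NC_stationary (sparse_set s) f x \<longleftrightarrow> restrict_to {i. x $ i \<noteq> 0} (grad f x) = 0"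
proof -
  let ?A = "{i. x $ i \<noteq> 0}" and ?g = "grad f x"
  have "NC_stationary (sparse_set s) f x \<longleftrightarrow> - ?g \<in> clarke_normal_cone (sparse_set s) x"
    using assms(2) by (auto simp: NC_stationary_def image_iff eq_commute[of 0] add_eq_0_iff)
  also have "\<dots> \<longleftrightarrow> (\<forall>z\<in>supported_on ?A. 0 \<le> restrict_to ?A ?g \<bullet> z)"
    by (simp add: clarke_normal_cone_def clarke_tangent_cone_sparse_set[OF assms]
        inner_supported_on[of _ ?A ?g])
  also have "\<dots> \<longleftrightarrow> restrict_to ?A ?g = 0"
  proof
    assume "\<forall>z\<in>supported_on ?A. 0 \<le> restrict_to ?A ?g \<bullet> z"
    \<comment> \<open>In this direction the inner product is minus the squared norm of the
      restricted gradient.\<close>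
    moreover have "- restrict_to ?A ?g \<in> supported_on ?A"
      by (simp add: restrict_to_def supported_on_def)
    ultimately have "0 \<le> restrict_to ?A ?g \<bullet> (- restrict_to ?A ?g)"
      by blast
    then show "restrict_to ?A ?g = 0"
      by (metis inner_minus_right neg_0_le_iff_le inner_gt_zero_iff not_le)
  qed simp
  finally show ?thesis .
qed

lemma TC_stationary_sparse_set_iff:
  fixes x :: "real ^ 'n"
  assumes "s < CARD('n)" and "x \<in> sparse_set s"
  shows "TC_stationary (sparse_set s) f x \<longleftrightarrow> restrict_to {i. x $ i \<noteq> 0} (grad f x) = 0"
  using assms(2) by (simp add: TC_stationary_def clarke_proj_grad_def
      clarke_tangent_cone_sparse_set[OF assms] arg_min_norm_supported_on)

lemma alpha_stationary_sparse_setD: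
  assumes "0 < \<alpha>" and "alpha_stationary \<alpha> (sparse_set s) f x"
  shows "restrict_to {i. x $ i \<noteq> 0} (grad f x) = 0"
proof -
  let ?A = "{i. x $ i \<noteq> 0}" and ?g = "grad f x"
  let ?p = "restrict_to ?A ?g"
  \<comment> \<open>A gradient step taken only on the support of \<open>x\<close>, which preserves
    sparsity.\<close>
  let ?y = "x - \<alpha> *\<^sub>R ?p"
  have x: "x \<in> sparse_set s"
    and min: "\<And>y. y \<in> sparse_set s \<Longrightarrow> norm (x - \<alpha> *\<^sub>R ?g - x) \<le> norm (x - \<alpha> *\<^sub>R ?g - y)"
    using assms(2) by (auto simp: alpha_stationary_def proj_set_def is_arg_min_def not_less)
  have "l0_norm ?y \<le> l0_norm x"
    by (rule l0_norm_mono) (auto simp: restrict_to_def)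
  then have "?y \<in> sparse_set s"
    using x by (simp add: sparse_set_def)
  from min[OF this] have "norm (\<alpha> *\<^sub>R ?g) \<le> norm (\<alpha> *\<^sub>R (?g - ?p))"
    by (simp add: algebra_simps norm_minus_commute)
  then have "(norm ?g)\<^sup>2 \<le> (norm (?g - ?p))\<^sup>2"
    using assms(1) by simp
  \<comment> \<open>The Pythagorean splitting at \<open>d = 0\<close>; with the previous inequality
    it forces \<open>?p\<close> to vanish.\<close>
  moreover have "(norm ?g)\<^sup>2 = (norm ?p)\<^sup>2 + (norm (?g - ?p))\<^sup>2"
    using norm_add_supported_on[of 0 ?A ?g] by (simp add: supported_on_def)
  ultimately show ?thesis by simp
qed

theorem theorem2p4:
  fixes f :: "real ^ 'n \<Rightarrow> real" and s :: nat and \<alpha> :: real and x :: "real ^ 'n"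
  assumes "0 < s" and "s < CARD('n)"
    and "\<And>y. f differentiable at y" and "continuous_on UNIV (grad f)"
    and "0 < \<alpha>" and "x \<in> sparse_set s"
  shows "(alpha_stationary \<alpha> (sparse_set s) f x \<longrightarrow> NC_stationary (sparse_set s) f x) \<and>
         (NC_stationary (sparse_set s) f x \<longleftrightarrow> TC_stationary (sparse_set s) f x)"
  using alpha_stationary_sparse_setD[OF assms(5)]
    NC_stationary_sparse_set_iff[OF assms(2,6)] TC_stationary_sparse_set_iff[OF assms(2,6)]
  by blast

end
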